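(* If $G$ is a $2$-connected graph, then $pc_{1,2}(G)\leq 5$.
   Context: All graphs are finite, undirected, simple and connected. An edge-coloring of a graph is an arbitrary map from its edge set to the natural numbers (adjacent edges may share a color). In an edge-colored graph, a path $P$ is a distance $2$-proper path if no two edges of $P$ of the same color appear with fewer than $2$ edges in between on $P$. The number $pc_{1,2}(G)$ is the minimum number of colors in an edge-coloring of $G$ such that every pair of distinct vertices of $G$ is connected by at least one distance $2$-proper path. *)

theory Defs
  imports "Graph_Theory.Graph_Theory" "HOL-Library.Extended_Nat"
begin

text \<open>
  A finite simple undirected graph is a \<^locale>\<open>pair_graph\<close>: a finite, loop-free, symmetric
  set of arcs.  An undirected edge is the doubleton \<open>{u, v}\<close> underlying the two arcs
  \<open>(u, v)\<close> and \<open>(v, u)\<close>; edge-colorings are defined on these doubletons, so both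
  directions of an edge automatically get the same color.
\<close>

definition edges :: "'a pair_pre_digraph \<Rightarrow> 'a set set" where
  "edges G = {{u, v} | u v. (u, v) \<in> parcs G}"

definition vpath_edges :: "'a vwalk \<Rightarrow> 'a set list" where
  "vpath_edges p = map (\<lambda>(u, v). {u, v}) (vwalk_arcs p)"

text \<open>
  The case \<open>card X = 0\<close> says that \<open>G\<close> itself is connected.
\<close>

definition k_connected :: "nat \<Rightarrow> 'a pair_pre_digraph \<Rightarrow> bool" where
  "k_connected k G \<longleftrightarrow> card (pverts G) > k \<and>
     (\<forall>X \<subseteq> pverts G. card X < k \<longrightarrow>
        Digraph_Component.connected (with_proj G \<restriction> (pverts G - X)))"

text \<open>
  Between the \<open>i\<close>-th and the \<open>j\<close>-th edge of a path, where \<open>i < j\<close>,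
  there are exactly \<open>j - i - 1\<close> edges.
\<close>

definition distance_2_proper_path ::
  "'a pair_pre_digraph \<Rightarrow> ('a set \<Rightarrow> nat) \<Rightarrow> 'a vwalk \<Rightarrow> bool" where
  "distance_2_proper_path G c p \<longleftrightarrow> vpath p (with_proj G) \<and>
     (\<forall>i j. i < j \<and> j < length (vpath_edges p) \<and> j - i - 1 < 2 \<longrightarrow>
        c (vpath_edges p ! i) \<noteq> c (vpath_edges p ! j))"

definition distance_2_proper_connecting ::
  "'a pair_pre_digraph \<Rightarrow> ('a set \<Rightarrow> nat) \<Rightarrow> bool" where
  "distance_2_proper_connecting G c \<longleftrightarrow>
     (\<forall>u \<in> pverts G. \<forall>v \<in> pverts G. u \<noteq> v \<longrightarrow>
        (\<exists>p. hd p = u \<and> last p = v \<and> distance_2_proper_path G c p))"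

text \<open>
  The minimum is taken in \<^typ>\<open>enat\<close>, so that it would be \<open>\<infinity>\<close> rather than an
  arbitrary number for a graph without any admissible coloring (a disconnected graph).
\<close>

definition pc_1_2 :: "'a pair_pre_digraph \<Rightarrow> enat" where
  "pc_1_2 G = (INF c \<in> {c. distance_2_proper_connecting G c}. enat (card (c ` edges G)))"

end

theory Submission
  imports Defs
begin

text \<open>
  Fix an edge \<open>{s, t}\<close> and build \<open>G\<close> from it by adding ears, maintaining an
  \<open>st\<close>-numbering \<open>r\<close>: the interior of an ear from \<open>p\<close> to \<open>q\<close>, where \<open>r p < r q\<close>, is
  numbered increasingly right after \<open>p\<close>.  An interior vertex can descend along its ear to \<open>p\<close>
  and on to \<open>s\<close>, and ascend along its ear to \<open>q\<close> and on to \<open>t\<close>.  If \<open>r u < r v\<close>, then the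
  descent from \<open>u\<close> to \<open>s\<close>, the edge \<open>{s, t}\<close> and the reversed ascent from \<open>v\<close> to \<open>t\<close> form a path.
  Five colors suffice to keep all descents and ascents proper: when the edges of a new ear are
  colored greedily from \<open>p\<close> to \<open>q\<close>, it is enough that each edge avoids the colors of the two edges
  that follow it on the descent and of the first two edges of the ascent from \<open>q\<close>.
  For the junction at \<open>{s, t}\<close>, this edge gets color 0, descents enter \<open>s\<close> through an edge of
  color 1, and ascents enter \<open>t\<close> through an edge whose color is neither 0 nor 1.
\<close>

section \<open>Color lists that are proper at distance 2\<close>

fun proper2 :: "'c list \<Rightarrow> bool" where
  "proper2 [] \<longleftrightarrow> True"
| "proper2 (x # xs) \<longleftrightarrow> x \<notin> set (take 2 xs) \<and> proper2 xs"

text \<open>Links the recursive form to the path condition: \<open>j - i - 1 < 2\<close> with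
  \<open>i < j\<close> means that \<open>j\<close> is one of the two positions after
  \<open>i\<close>, the window tested by \<open>take 2\<close>. The recursion suits lists that grow
  edge by edge.\<close>

lemma proper2_nth:
  assumes "proper2 xs" "i < j" "j < length xs" "j - i - 1 < 2"
  shows "xs ! i \<noteq> xs ! j"
  using assms
proof (induction xs arbitrary: i j)
  case (Cons x xs)
  obtain j' where j: "j = Suc j'" using Cons.prems(2) by (cases j) auto
  show ?case
  proof (cases i)
    case 0
    then have "j' < 2" using Cons.prems j by simp
    then have "xs ! j' \<in> set (take 2 xs)"
      using Cons.prems(3) j by (auto simp: in_set_conv_nth intro!: exI[of _ j'])
    then show ?thesis using Cons.prems(1) 0 j by auto
  next
    case (Suc i')
    then show ?thesis using Cons.IH[of i' j'] Cons.prems j by simp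
  qed
qed simp

lemma proper2_append_right: "proper2 (xs @ ys) \<Longrightarrow> proper2 ys"
  by (induction xs) auto

lemma proper2_append_left: "proper2 (xs @ ys) \<Longrightarrow> proper2 xs"
  by (induction xs) auto

lemma proper2_snoc: "proper2 (xs @ [y]) \<longleftrightarrow> proper2 xs \<and> y \<notin> set (take 2 (rev xs))"
proof (induction xs)
  case (Cons x xs)
  consider "xs = []" | a where "xs = [a]" | a b where "xs = [a, b]"
    | "length xs \<ge> 3"
    by (cases xs; cases "tl xs"; cases "tl (tl xs)") auto
  then show ?case
    by cases (use Cons in \<open>auto\<close>)
qed simp

lemma proper2_rev: "proper2 (rev xs) \<longleftrightarrow> proper2 xs"
  by (induction xs) (auto simp: proper2_snoc)

text \<open>The condition looks only two entries ahead, so a shared block of two entries shields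
  \<open>xs\<close> from everything in \<open>ys\<close>.\<close>

lemma proper2_overlap:
  "proper2 (xs @ [a, b]) \<Longrightarrow> proper2 (a # b # ys) \<Longrightarrow> proper2 (xs @ a # b # ys)"
proof (induction xs)
  case (Cons x xs)
  have "take 2 (xs @ a # b # ys) = take 2 (xs @ [a, b])" by (auto simp: take_Cons' numeral_2_eq_2)
  with Cons show ?case by simp
qed simp

lemma avoid_colors:
  fixes A :: "nat set"
  assumes "finite A" "card A < n"
  shows "\<exists>e<n. e \<notin> A"
proof (rule ccontr)
  assume "\<not> ?thesis"
  then have "{..<n} \<subseteq> A" by auto
  then show False using card_mono[OF assms(1), of "{..<n}"] assms(2) by simp
qed

lemma card_set_take: "card (set (take n xs)) \<le> n"
  using card_length[of "take n xs"] by simp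

text \<open>Greedy choice: \<open>\<gamma>\<close> lists the colors that follow on the way down and
  absorbs each new color, while \<open>\<beta>\<close> stays fixed as the colors of the way up. At
  most four colors are forbidden at each step. Conflicts inside \<open>es\<close> are excluded by
  the downward list, since properness survives reversal; conflicts with \<open>\<beta>\<close> are
  excluded by avoiding its first two entries at every step.\<close>

lemma ear_colors:
  fixes \<gamma> \<beta> :: "nat list"
  assumes "proper2 \<gamma>" "proper2 \<beta>"
  shows "\<exists>es. length es = n \<and> set es \<subseteq> {..<5} \<and> proper2 (rev es @ \<gamma>) \<and> proper2 (es @ \<beta>)"
  using assms(1)
proof (induction n arbitrary: \<gamma>)
  case 0
  then show ?case using assms(2) by simp
next
  case (Suc n)
  let ?A = "set (take 2 \<gamma>) \<union> set (take 2 \<beta>)"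
  have "card ?A \<le> 4"
    using card_Un_le[of "set (take 2 \<gamma>)" "set (take 2 \<beta>)"] card_set_take[of 2 \<gamma>]
      card_set_take[of 2 \<beta>] by linarith
  then obtain e where e: "e < 5" "e \<notin> ?A" using avoid_colors[of ?A 5] by auto
  with Suc.prems have "proper2 (e # \<gamma>)" by simp
  from Suc.IH[OF this] obtain es where es: "length es = n" "set es \<subseteq> {..<5}"
    "proper2 (rev es @ e # \<gamma>)" "proper2 (es @ \<beta>)" by blast
  have "proper2 (rev es @ [e])" using proper2_append_left[of "rev es @ [e]" \<gamma>] es(3) by simp
  then have "e \<notin> set (take 2 es)" by (simp add: proper2_snoc)
  \<comment> \<open>After the \<open>n\<close> entries of \<open>es\<close>, the window of
    \<open>e\<close> reaches \<open>2 - n\<close> entries into \<open>\<beta>\<close>; truncated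
    subtraction makes this none for \<open>n \<ge> 2\<close>.\<close>
  moreover have "e \<notin> set (take (2 - n) \<beta>)"
    using e(2) set_take_subset_set_take[of "2 - n" 2 \<beta>] by auto
  ultimately have "proper2 (e # es @ \<beta>)" using es(1,4) by simp
  then show ?case using es e(1) by (intro exI[of _ "e # es"]) simp
qed

lemma ex_recolor:
  assumes "distinct xs" "length es = length xs"
  shows "\<exists>c'. map c' xs = es \<and> (\<forall>x. x \<notin> set xs \<longrightarrow> c' x = c x)"
  using assms(2,1)
proof (induction es xs rule: list_induct2)
  case (Cons e es x xs)
  then obtain c' where c': "map c' xs = es" "\<forall>x. x \<notin> set xs \<longrightarrow> c' x = c x" by auto
  show ?case
    using c' Cons.prems by (intro exI[of _ "c'(x := e)"]) auto
qed auto

section \<open>Edge lists of walks, concatenation and reversal\<close>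

lemma vpath_edges_simps [simp]:
  "vpath_edges [] = []" "vpath_edges [u] = []"
  "vpath_edges (u # v # p) = {u, v} # vpath_edges (v # p)"
  by (simp_all add: vpath_edges_def)

lemma vpath_edges_append:
  "vpath_edges (p @ x # q) = vpath_edges (p @ [x]) @ vpath_edges (x # q)"
  by (induction p rule: vwalk_arcs.induct) auto

lemma vpath_edges_rev: "vpath_edges (rev p) = rev (vpath_edges p)"
proof (induction p rule: vwalk_arcs.induct)
  case (3 x y xs)
  then show ?case using vpath_edges_append[of "rev xs" y "[x]"] by (simp add: insert_commute)
qed auto

lemma length_vpath_edges [simp]: "length (vpath_edges p) = length p - 1"
  by (induction p rule: vwalk_arcs.induct) auto

lemma vpath_edges_subset: "e \<in> set (vpath_edges p) \<Longrightarrow> e \<subseteq> set p"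
  by (induction p rule: vwalk_arcs.induct) auto

lemma distinct_vpath_edges: "distinct p \<Longrightarrow> distinct (vpath_edges p)"
proof (induction p rule: vwalk_arcs.induct)
  case (3 x y xs)
  then show ?case using vpath_edges_subset[of "{x, y}" "y # xs"] by auto
qed auto

lemma vwalk_append:
  "vwalk (p @ [x]) G \<Longrightarrow> vwalk (x # q) G \<Longrightarrow> vwalk (p @ x # q) G"
  by (induction p rule: vwalk_arcs.induct) (auto simp: vwalk_def)

lemma (in pair_graph) vwalk_rev: "vwalk p (with_proj G) \<Longrightarrow> vwalk (rev p) (with_proj G)"
proof (induction p rule: vwalk_arcs.induct)
  case (3 x y xs)
  then have "vwalk [y, x] (with_proj G)"
    using arcs_symmetric by (auto simp: vwalk_def)
  moreover have "vwalk (rev xs @ [y]) (with_proj G)"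
    using 3 by (auto simp: vwalk_def)
  ultimately show ?case using vwalk_append[of "rev xs" y "with_proj G" "[x]"] by simp
qed auto

section \<open>Ears in a 2-connected graph\<close>

lemma (in pair_graph) ex_vpath_avoiding:
  assumes "k_connected 2 G" "X \<subseteq> pverts G" "card X < 2" "u \<in> pverts G - X" "v \<in> pverts G - X"
  shows "\<exists>w. vpath w (with_proj G) \<and> hd w = u \<and> last w = v \<and> set w \<inter> X = {}"
proof -
  \<comment> \<open>Connectedness of a digraph is strong connectedness of its symmetric closure, so
    the path is found in \<open>?H\<close>. Symmetry of \<open>G\<close> brings the arcs of
    \<open>?H\<close> back into \<open>G\<close>.\<close>
  let ?H = "mk_symmetric (with_proj G \<restriction> (pverts G - X))"
  have *: "pverts ?H = pverts G - X" by simp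
  have arcs: "parcs ?H \<subseteq> parcs G" 
    by (auto simp: parcs_mk_symmetric intro: arcs_symmetric)
  interpret H: wf_digraph "with_proj ?H"
    by (simp add: wf_digraph_wp_iff) (rule wf_digraph.wellformed_mk_symmetric; rule wellformed_induce_subgraph)
  have "Digraph_Component.connected (with_proj G \<restriction> (pverts G - X))"
    using assms by (auto simp: k_connected_def)
  then have "u \<rightarrow>\<^sup>*\<^bsub>with_proj ?H\<^esub> v"
    using assms by (auto simp: connected_def strongly_connected_def)
  then obtain w where "vpath w (with_proj ?H)" "hd w = u" "last w = v"
    using H.reachable_vpath_conv by blast
  then show ?thesis using arcs * by (intro exI[of _ w]) (auto simp: vpath_def vwalk_def)
qed

text \<open>Follow a path from outside until it first meets \<open>S\<close>, at \<open>p\<close>,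
  and let \<open>x\<close> be the vertex just before. Deleting \<open>p\<close> leaves
  \<open>x\<close> connected to the rest of \<open>S\<close>; a path from \<open>x\<close> avoiding
  \<open>p\<close>, cut at its first vertex \<open>q\<close> in \<open>S\<close>, completes the ear,
  and \<open>q\<close> differs from \<open>p\<close>.\<close>

lemma (in pair_graph) ear_exists:
  assumes "k_connected 2 G" "S \<subset> pverts G" "s \<in> S" "t \<in> S" "s \<noteq> t"
  obtains p xs q where "vpath (p # xs @ [q]) (with_proj G)" "p \<in> S" "q \<in> S"
    "xs \<noteq> []" "set xs \<inter> S = {}"
proof -
  obtain y where y: "y \<in> pverts G - S" using assms(2) by blast
  obtain w where w: "vpath w (with_proj G)" "hd w = y" "last w = s"
    using ex_vpath_avoiding[of "{}" y s] assms y by auto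
  have ne: "w \<noteq> []" using w by auto
  have "\<exists>z\<in>set w. z \<in> S" using w assms ne last_in_set by blast
  then obtain as p bs where p: "w = as @ p # bs" "p \<in> S" "\<forall>a\<in>set as. a \<notin> S"
    using split_list_first_prop[of w "\<lambda>z. z \<in> S"] by blast
  have "as \<noteq> []" using p w y by auto
  then obtain as' x where as: "as = as' @ [x]" using rev_exhaust by blast
  have "vwalk w (with_proj G)" using w by blast
  then have xp: "x \<in> pverts G" "(x, p) \<in> parcs G" and xS: "x \<notin> S"
    using p(1,3) as vwalk_arcs_append[of as "p # bs"] by (auto simp: vwalk_def)
  obtain q0 where q0: "q0 \<in> S" "q0 \<noteq> p" using assms by metis
  obtain w' where w': "vpath w' (with_proj G)" "hd w' = x" "last w' = q0" "set w' \<inter> {p} = {}"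
    using ex_vpath_avoiding[of "{p}" x q0] assms q0 xp xS p by auto
  have ne: "w' \<noteq> []" using w' by auto
  have "\<exists>z\<in>set w'. z \<in> S" using w' q0 ne last_in_set by blast
  then obtain xs q bs' where q: "w' = xs @ q # bs'" "q \<in> S" "\<forall>a\<in>set xs. a \<notin> S"
    using split_list_first_prop[of w' "\<lambda>z. z \<in> S"] by blast
  have xs: "xs \<noteq> []" using q w' xS by auto
  have "vwalk (xs @ [q]) (with_proj G)"
    using w'(1) q(1) vwalkI_append_l[of "xs @ [q]" bs'] by (auto simp: vpath_def)
  moreover have "hd (xs @ [q]) = x" using q(1) w'(2) xs by simp
  ultimately have "vwalk (p # xs @ [q]) (with_proj G)"
    using arcs_symmetric[OF xp(2)] p(2) assms(2) by (auto intro!: vwalk_consI)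
  then have "vpath (p # xs @ [q]) (with_proj G)"
    using w' q(1) by (auto simp: vpath_def)
  then show thesis using that p q xs by blast
qed


section \<open>Rooted paths and their extension along an ear\<close>

lemma ear_edge_meets_interior:
  "xs \<noteq> [] \<Longrightarrow> e \<in> set (vpath_edges (p # xs @ [q])) \<Longrightarrow> e \<inter> set xs \<noteq> {}"
proof (induction xs arbitrary: p)
  case (Cons x xs)
  then show ?case by (cases "xs = []") auto
qed simp

lemma map_vpath_edges_cong:
  assumes "set P \<subseteq> S" "\<And>e. e \<subseteq> S \<Longrightarrow> c' e = c e"
  shows "map c' (vpath_edges P) = map c (vpath_edges P)"
  using assms vpath_edges_subset by (metis (no_types, lifting) map_cong order_trans)

lemma vpath_hd_eq_last:
  "vpath P G \<Longrightarrow> hd P = last P \<Longrightarrow> P = [hd P]"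
  by (cases P) (auto simp: vpath_def split: if_splits)

text \<open>The list \<open>\<sigma>\<close> holds colors still to come beyond the root, so that
  properness across a later continuation is already recorded.\<close>

definition rooted_path ::
  "'a pair_pre_digraph \<Rightarrow> ('a set \<Rightarrow> nat) \<Rightarrow> 'a \<Rightarrow> nat list \<Rightarrow> 'a \<Rightarrow> 'a vwalk \<Rightarrow> bool" where
  "rooted_path G c r \<sigma> v P \<longleftrightarrow> vpath P (with_proj G) \<and> hd P = v \<and> last P = r \<and>
     proper2 (map c (vpath_edges P) @ \<sigma>)"

lemma rooted_path_cong:
  assumes "rooted_path G c r \<sigma> v P" "set P \<subseteq> S" "\<And>e. e \<subseteq> S \<Longrightarrow> c' e = c e"
  shows "rooted_path G c' r \<sigma> v P"
  using assms(1) map_vpath_edges_cong[of P S c' c] assms(2,3) unfolding rooted_path_def by metis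

text \<open>Serves both ends of an ear: \<open>zs\<close> is the stretch from a new vertex up to the
  attachment vertex \<open>p\<close>, where the old path \<open>P\<close> takes over. As
  \<open>zs\<close> misses \<open>S\<close>, no vertex repeats, and the edges of \<open>P\<close>
  keep their colors.\<close>

lemma rooted_path_extend:
  assumes P: "rooted_path G c r \<sigma> p P" "set P \<subseteq> S" "\<And>e. e \<subseteq> S \<Longrightarrow> c' e = c e"
    and zs: "vpath (zs @ [p]) (with_proj G)" "zs \<noteq> []" "set zs \<inter> S = {}"
    and c': "proper2 (map c' (vpath_edges (zs @ [p])) @ map c (vpath_edges P) @ \<sigma>)"
  shows "rooted_path G c' r \<sigma> (hd zs) (zs @ P)"
    and "map c' (vpath_edges (zs @ P)) = map c' (vpath_edges (zs @ [p])) @ map c (vpath_edges P)"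
proof -
  obtain P' where P': "P = p # P'"
    using P(1) by (cases P) (auto simp: rooted_path_def vpath_def)
  show *: "map c' (vpath_edges (zs @ P)) = map c' (vpath_edges (zs @ [p])) @ map c (vpath_edges P)"
    using vpath_edges_append[of zs p P'] map_vpath_edges_cong[of P S c' c] P(2,3) P' by simp
  have "vwalk (zs @ P) (with_proj G)"
    using vwalk_append[of zs p "with_proj G" P'] zs P P' by (simp add: rooted_path_def vpath_def)
  moreover have "distinct (zs @ P)"
    using zs P by (auto simp: rooted_path_def vpath_def)
  ultimately show "rooted_path G c' r \<sigma> (hd zs) (zs @ P)"
    using * c' P(1) P' zs(2) by (simp add: rooted_path_def vpath_def)
qed

text \<open>
  Appending \<open>[0]\<close> accounts for the edge \<open>{s, t}\<close>.  Appending \<open>[0, 1]\<close> adds the color 1 of the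
  last edge of any descent, so that the junction is proper whichever descent follows.
\<close>

definition st_coloring ::
  "'a pair_pre_digraph \<Rightarrow> 'a \<Rightarrow> 'a \<Rightarrow> 'a set \<Rightarrow> ('a \<Rightarrow> nat) \<Rightarrow> ('a set \<Rightarrow> nat) \<Rightarrow> bool" where
  "st_coloring G s t S r c \<longleftrightarrow> s \<in> S \<and> t \<in> S \<and> S \<subseteq> pverts G \<and> inj_on r S \<and>
     r s = 0 \<and> (\<forall>v\<in>S. r v \<le> r t) \<and> (\<forall>e. c e < 5) \<and> c {s, t} = 0 \<and>
     (\<forall>v\<in>S - {t}. \<exists>P. rooted_path G c s [0] v P \<and> set P \<subseteq> {w \<in> S. r w \<le> r v} \<and>
        (v \<noteq> s \<longrightarrow> last (map c (vpath_edges P)) = 1)) \<and>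
     (\<forall>v\<in>S - {s}. \<exists>Q. rooted_path G c t [0, 1] v Q \<and> set Q \<subseteq> {w \<in> S. r v \<le> r w})"

section \<open>Building an st-coloring ear by ear\<close>

lemma st_coloring_edge:
  assumes "s \<in> pverts G" "t \<in> pverts G" "s \<noteq> t"
  shows "st_coloring G s t {s, t} (\<lambda>v. if v = s then 0 else 1) (\<lambda>_. 0)"
proof -
  \<comment> \<open>Only \<open>s\<close> needs a descent and only \<open>t\<close> an ascent here,
    so the one-vertex paths suffice and a constant coloring does no harm.\<close>
  have "rooted_path G (\<lambda>_. 0) s [0] s [s]" "rooted_path G (\<lambda>_. 0) t [0, 1] t [t]"
    using assms by (simp_all add: rooted_path_def vpath_def vwalk_def)
  moreover from this have "\<exists>P. rooted_path G (\<lambda>_. 0) s [0] s P \<and> set P \<subseteq> {s}"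
    "\<exists>Q. rooted_path G (\<lambda>_. 0) t [0, 1] t Q \<and> set Q \<subseteq> {t}"
    by (metis order_refl list.set(1) list.simps(15))+
  ultimately show ?thesis
    using assms unfolding st_coloring_def
    by (auto simp: inj_on_def subset_iff)
qed

text \<open>Old vertices keep their paths, because colors inside \<open>S\<close> and the order on
  \<open>S\<close> are unchanged. A new vertex runs back along the ear to \<open>p\<close> and
  continues with \<open>P\<close>, or forward to \<open>q\<close> and continues with
  \<open>Q\<close>.\<close>

lemma (in pair_graph) st_coloring_add_ear:
  assumes inv: "st_coloring G s t S r c"
    and ear: "vpath (p # xs @ [q]) (with_proj G)" "p \<in> S" "q \<in> S" "xs \<noteq> []" "set xs \<inter> S = {}"
    and less: "r p < r q"
  shows "\<exists>r' c'. st_coloring G s t (S \<union> set xs) r' c'"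
proof -
  have S: "s \<in> S" "t \<in> S" "S \<subseteq> pverts G" "inj_on r S" "r s = 0" "\<And>v. v \<in> S \<Longrightarrow> r v \<le> r t"
    and c: "\<And>e. c e < 5" "c {s, t} = 0"
    and down: "\<And>v. v \<in> S \<Longrightarrow> v \<noteq> t \<Longrightarrow> \<exists>P. rooted_path G c s [0] v P \<and>
        set P \<subseteq> {w \<in> S. r w \<le> r v} \<and> (v \<noteq> s \<longrightarrow> last (map c (vpath_edges P)) = 1)"
    and up: "\<And>v. v \<in> S \<Longrightarrow> v \<noteq> s \<Longrightarrow> \<exists>Q. rooted_path G c t [0, 1] v Q \<and>
        set Q \<subseteq> {w \<in> S. r v \<le> r w}"
    using inv unfolding st_coloring_def by blast+
  have "p \<noteq> t" using S(6)[OF ear(3)] less by auto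
  from down[OF ear(2) this] obtain P where P: "rooted_path G c s [0] p P"
    "set P \<subseteq> {w \<in> S. r w \<le> r p}" "p \<noteq> s \<Longrightarrow> last (map c (vpath_edges P)) = 1" by blast
  have "q \<noteq> s" using S(5) less by auto
  from up[OF ear(3) this] obtain Q where Q: "rooted_path G c t [0, 1] q Q"
    "set Q \<subseteq> {w \<in> S. r q \<le> r w}" by blast
  let ?\<alpha> = "map c (vpath_edges P) @ [0]" and ?\<beta> = "map c (vpath_edges Q) @ [0, 1]"
  have Ps: "P = [s]" if "p = s"
    using P(1) that vpath_hd_eq_last[of P] by (auto simp: rooted_path_def)
  have Pe: "vpath_edges P \<noteq> []" if "p \<noteq> s"
    using P(1) that by (cases P rule: vwalk_arcs.cases) (auto simp: rooted_path_def)
  have \<alpha>: "proper2 ?\<alpha>" "proper2 ?\<beta>" using P(1) Q(1) by (simp_all add: rooted_path_def)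
  \<comment> \<open>The ear edge at \<open>p\<close> lies on no ascent of an interior vertex, so it
    need not respect \<open>?\<beta>\<close>. This leaves it free to take color 1 when
    \<open>p = s\<close>.\<close>
  have "\<exists>e<5. proper2 (e # ?\<alpha>) \<and> (p = s \<longrightarrow> e = 1)"
  proof (cases "p = s")
    case True
    then show ?thesis using Ps by (intro exI[of _ 1]) simp
  next
    case False
    obtain e :: nat where "e < 5" "e \<notin> set (take 2 ?\<alpha>)"
      using avoid_colors[of "set (take 2 ?\<alpha>)" 5] card_set_take[of 2 ?\<alpha>] by fastforce
    then show ?thesis using \<alpha> False by auto
  qed
  then obtain e0 where e0: "e0 < 5" "proper2 (e0 # ?\<alpha>)" "p = s \<Longrightarrow> e0 = 1" by blast
  obtain es where es: "length es = length xs" "set es \<subseteq> {..<5}"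
    "proper2 (rev es @ e0 # ?\<alpha>)" "proper2 (es @ ?\<beta>)"
    using ear_colors[OF e0(2) \<alpha>(2)] by blast
  let ?E = "vpath_edges (p # xs @ [q])"
  have len: "length (e0 # es) = length ?E" using es(1) by simp
  have "distinct ?E" using ear(1) distinct_vpath_edges by (blast elim: vpathE)
  then obtain c' where c': "map c' ?E = e0 # es" "\<And>e. e \<notin> set ?E \<Longrightarrow> c' e = c e"
    using ex_recolor[of ?E "e0 # es" c, OF _ len] by metis
  \<comment> \<open>Every ear edge contains an interior vertex of the ear, so no subset of
    \<open>S\<close> is recolored.\<close>
  have agree: "c' e = c e" if "e \<subseteq> S" for e
    using c'(2)[of e] ear_edge_meets_interior[OF ear(4), of e p q] that ear(5) by blast
  have c'5: "c' e < 5" for e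
  proof (cases "e \<in> set ?E")
    case True
    then have "c' e \<in> set (e0 # es)" using c'(1) by (metis image_eqI list.set_map)
    then show ?thesis using e0(1) es(2) by auto
  qed (use c'(2) c(1) in simp)
  \<comment> \<open>Stretching old numbers by \<open>N\<close> opens \<open>length xs\<close> free
    values between \<open>N * r p\<close> and \<open>N * Suc (r p)\<close>. The
    \<open>takeWhile\<close> length is the position of \<open>w\<close> in \<open>xs\<close>, and
    the \<open>Suc\<close> keeps the first interior vertex above \<open>p\<close>.\<close>
  define N where "N = Suc (length xs)"
  define r' where "r' w = (if w \<in> S then N * r w
    else N * r p + Suc (length (takeWhile (\<lambda>y. y \<noteq> w) xs)))" for w
  have dist: "distinct (p # xs @ [q])" using ear(1) by blast
  have r'_old: "r' v \<le> r' w \<longleftrightarrow> r v \<le> r w" if "v \<in> S" "w \<in> S" for v w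
    using that by (simp add: r'_def N_def del: mult_Suc)
  have r'_new: "r' x = N * r p + Suc (length as)" if "xs = as @ x # bs" for as x bs
  proof -
    have "x \<notin> S" "x \<notin> set as" using that ear(5) dist by auto
    then have "takeWhile (\<lambda>y. y \<noteq> x) xs = as"
      using that by (auto simp: takeWhile_append)
    then show ?thesis using \<open>x \<notin> S\<close> by (simp add: r'_def)
  qed
  have r'_low: "r' w < r' x" if w: "w \<in> S" "r w \<le> r p" "x \<in> set xs" for w x
  proof -
    obtain as bs where "xs = as @ x # bs" using split_list[OF w(3)] by blast
    then have "r' x = N * r p + Suc (length as)" by (rule r'_new)
    moreover have "r' w \<le> N * r p" using that by (simp add: r'_def)
    ultimately show ?thesis by simp
  qed
  have r'_high: "r' x < r' w" if w: "w \<in> S" "r p < r w" "x \<in> set xs" for w x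
  proof -
    obtain as bs where x: "xs = as @ x # bs" using split_list[OF w(3)] by blast
    then have "r' x = N * r p + Suc (length as)" by (rule r'_new)
    moreover have "r' w \<ge> N * Suc (r p)" using that by (simp add: r'_def del: mult_Suc_right)
    ultimately show ?thesis using x by (simp add: N_def)
  qed
  have inj: "inj_on r' (S \<union> set xs)"
  proof -
    have "inj_on r' S" using S(4) r'_old by (metis antisym inj_on_def order_refl)
    moreover have "inj_on r' (set xs)"
    proof (rule inj_onI)
      fix x y assume xy: "x \<in> set xs" "y \<in> set xs" "r' x = r' y"
      obtain as bs where x: "xs = as @ x # bs" using xy split_list by metis
      obtain as' bs' where y: "xs = as' @ y # bs'" using xy split_list by metis
      have "length as = length as'" using r'_new[OF x] r'_new[OF y] xy by simp
      then show "x = y" using x y by (metis nth_append_length)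
    qed
    moreover have "r' w \<noteq> r' x" if "w \<in> S" "x \<in> set xs" for w x
      using r'_low[of w x] r'_high[of w x] that by (cases "r w \<le> r p") auto
    ultimately show ?thesis by (fastforce simp: inj_on_Un)
  qed
  have PS: "set P \<subseteq> S" "set Q \<subseteq> S" using P(2) Q(2) by auto
  have new: "\<exists>P. rooted_path G c' s [0] x P \<and> set P \<subseteq> {w \<in> S \<union> set xs. r' w \<le> r' x} \<and>
        last (map c' (vpath_edges P)) = 1" (is ?down)
    "\<exists>Q. rooted_path G c' t [0, 1] x Q \<and> set Q \<subseteq> {w \<in> S \<union> set xs. r' x \<le> r' w}" (is ?up)
    if x_in: "x \<in> set xs" for x
  proof -
    obtain as bs where x: "xs = as @ x # bs" using x_in split_list by metis
    have E: "?E = vpath_edges (p # as @ [x]) @ vpath_edges (x # bs @ [q])"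
      using vpath_edges_append[of "p # as" x "bs @ [q]"] x by simp
    have "vpath_edges (p # as @ [x]) \<noteq> []" by (cases as) auto
    then obtain e E' where E': "vpath_edges (p # as @ [x]) = e # E'" by (meson neq_Nil_conv)
    define es1 es2 where "es1 = map c' E'" and "es2 = map c' (vpath_edges (x # bs @ [q]))"
    have split: "es = es1 @ es2" "map c' (vpath_edges (p # as @ [x])) = e0 # es1"
      "map c' (vpath_edges (x # bs @ [q])) = es2"
      using c'(1) unfolding E E' es1_def es2_def by auto
    have walk: "vwalk ((p # as) @ x # bs @ [q]) (with_proj G)" using ear(1) x by (simp add: vpath_def)
    have "vwalk (p # as @ [x]) (with_proj G)"
      using vwalkI_append_l[of "p # as @ [x]" "bs @ [q]"] walk by simp
    from vwalk_rev[OF this] have w1: "vpath ((x # rev as) @ [p]) (with_proj G)"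
      using dist x by (auto simp: vpath_def)
    have w2: "vpath ((x # bs) @ [q]) (with_proj G)"
      using vwalkI_append_r[OF _ walk] dist x by (auto simp: vpath_def)
    have "vpath_edges ((x # rev as) @ [p]) = rev (vpath_edges (p # as @ [x]))"
      using vpath_edges_rev[of "p # as @ [x]"] by simp
    then have col: "map c' (vpath_edges ((x # rev as) @ [p])) = rev es1 @ [e0]"
      using split(2) by (simp add: rev_map[symmetric])
    \<comment> \<open>The entries of \<open>rev es2\<close> belong to edges beyond \<open>x\<close>,
      which the descent from \<open>x\<close> does not use.\<close>
    have "proper2 (rev es1 @ e0 # ?\<alpha>)"
      using es(3) split(1) proper2_append_right[of "rev es2"] by simp
    then have pr: "proper2 (map c' (vpath_edges ((x # rev as) @ [p])) @ map c (vpath_edges P) @ [0])"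
      by (simp only: col) simp
    have int: "set (x # rev as) \<inter> S = {}" "set (x # bs) \<inter> S = {}" using x ear(5) by auto
    note ext = rooted_path_extend[OF P(1) PS(1) agree w1 _ int(1) pr, simplified]
    \<comment> \<open>If \<open>p = s\<close>, the last edge is the ear edge at \<open>s\<close>,
      colored \<open>e0 = 1\<close>; otherwise it is the last edge of \<open>P\<close>.\<close>
    have "last (map c' (vpath_edges (x # rev as @ P))) = 1"
      using ext(2) col P(3) Pe e0(3) Ps by (cases "p = s") (auto simp: last_append)
    moreover have "r' w \<le> r' x" if w: "w \<in> set as" for w
    proof -
      obtain as1 as2 where "as = as1 @ w # as2" using split_list[OF w] by blast
      then show ?thesis using r'_new[of as1 w "as2 @ x # bs"] r'_new[OF x] x by simp
    qed
    moreover have "r' w \<le> r' x" if "w \<in> set P" for w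
      using r'_low[of w x] P(2) that x_in by fastforce
    ultimately show ?down
      using ext(1) x PS by (intro exI[of _ "x # rev as @ P"]) auto
    have pr: "proper2 (map c' (vpath_edges ((x # bs) @ [q])) @ map c (vpath_edges Q) @ [0, 1])"
      using es(4) split(1,3) proper2_append_right[of es1] by simp
    note ext = rooted_path_extend[OF Q(1) PS(2) agree w2 _ int(2) pr, simplified]
    moreover have "r' x \<le> r' w" if w: "w \<in> set bs" for w
    proof -
      obtain bs1 bs2 where "bs = bs1 @ w # bs2" using split_list[OF w] by blast
      then show ?thesis using r'_new[of "as @ x # bs1" w "bs2"] r'_new[OF x] x by simp
    qed
    moreover have "r' x \<le> r' w" if "w \<in> set Q" for w
      using r'_high[of w x] Q(2) that x_in less by fastforce
    ultimately show ?up
      using x PS by (intro exI[of _ "x # bs @ Q"]) auto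
  qed
  have old_down: "\<exists>P. rooted_path G c' s [0] v P \<and> set P \<subseteq> {w \<in> S \<union> set xs. r' w \<le> r' v} \<and>
      (v \<noteq> s \<longrightarrow> last (map c' (vpath_edges P)) = 1)" if v: "v \<in> S" "v \<noteq> t" for v
  proof -
    obtain P where P: "rooted_path G c s [0] v P" "set P \<subseteq> {w \<in> S. r w \<le> r v}"
      "v \<noteq> s \<longrightarrow> last (map c (vpath_edges P)) = 1" using down[OF v] by blast
    have PS: "set P \<subseteq> S" using P(2) by auto
    then have "set P \<subseteq> {w \<in> S \<union> set xs. r' w \<le> r' v}" using P(2) r'_old v by auto
    moreover have "map c' (vpath_edges P) = map c (vpath_edges P)"
      using PS agree by (rule map_vpath_edges_cong)
    with P(3) have "v \<noteq> s \<longrightarrow> last (map c' (vpath_edges P)) = 1" by (simp only:)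
    moreover have "rooted_path G c' s [0] v P" using P(1) PS agree by (rule rooted_path_cong)
    ultimately show ?thesis by blast
  qed
  have old_up: "\<exists>Q. rooted_path G c' t [0, 1] v Q \<and> set Q \<subseteq> {w \<in> S \<union> set xs. r' v \<le> r' w}"
    if v: "v \<in> S" "v \<noteq> s" for v
  proof -
    obtain Q where Q: "rooted_path G c t [0, 1] v Q" "set Q \<subseteq> {w \<in> S. r v \<le> r w}"
      using up[OF v] by blast
    have QS: "set Q \<subseteq> S" using Q(2) by auto
    then have "set Q \<subseteq> {w \<in> S \<union> set xs. r' v \<le> r' w}" using Q(2) r'_old v by auto
    moreover have "rooted_path G c' t [0, 1] v Q" using Q(1) QS agree by (rule rooted_path_cong)
    ultimately show ?thesis by blast
  qed
  \<comment> \<open>An interior vertex stays below \<open>t\<close> because \<open>r p < r q\<close>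
    and \<open>r q \<le> r t\<close>.\<close>
  have "r' v \<le> r' t" if "v \<in> S \<union> set xs" for v
    using that r'_old[of v t] r'_high[of t v] S(2,6) S(6)[OF ear(3)] less by fastforce
  moreover have "S \<union> set xs \<subseteq> pverts G" using S(3) ear(1) by (auto simp: vpath_def vwalk_def)
  moreover have "r' s = 0" using S by (simp add: r'_def)
  moreover have "c' {s, t} = 0" using agree[of "{s, t}"] S c by simp
  ultimately have "st_coloring G s t (S \<union> set xs) r' c'"
    unfolding st_coloring_def
    using S(1,2) inj c'5 new old_down old_up by (intro conjI ballI allI impI) (assumption | blast)+
  then show ?thesis by blast
qed

text \<open>Induction on the number of vertices not yet covered: each ear has a nonempty interior
  outside \<open>S\<close>, so the number drops until \<open>S\<close> is everything.\<close>

lemma (in pair_graph) st_coloring_exists: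
  assumes "k_connected 2 G" "s \<in> pverts G" "t \<in> pverts G" "s \<noteq> t"
  shows "\<exists>r c. st_coloring G s t (pverts G) r c"
proof -
  have "\<exists>r c. st_coloring G s t (pverts G) r c" if "st_coloring G s t S r c" for S r c
    using that
  proof (induction "card (pverts G - S)" arbitrary: S r c rule: less_induct)
    case less
    then have S: "s \<in> S" "t \<in> S" "S \<subseteq> pverts G" "inj_on r S"
      by (simp_all add: st_coloring_def)
    show ?case
    proof (cases "S = pverts G")
      case False
      obtain p xs q where ear: "vpath (p # xs @ [q]) (with_proj G)" "p \<in> S" "q \<in> S"
        "xs \<noteq> []" "set xs \<inter> S = {}"
        using ear_exists[OF assms(1) _ S(1,2) assms(4)] False S(3) by blast
      \<comment> \<open>Either direction of the ear may be needed, so that it starts at the end with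
        the smaller number.\<close>
      have rev: "vpath (q # rev xs @ [p]) (with_proj G)"
        using ear(1) vwalk_rev[of "p # xs @ [q]"] by (auto simp: vpath_def)
      have "r p \<noteq> r q" using ear(1-3) S(4) by (auto simp: vpath_def inj_on_def)
      then obtain r' c' where new: "st_coloring G s t (S \<union> set xs) r' c'"
        using st_coloring_add_ear[OF less.prems ear]
          st_coloring_add_ear[OF less.prems rev ear(3,2)] ear(4,5) by (fastforce simp: neq_iff)
      have "set xs \<subseteq> pverts G" using new by (simp add: st_coloring_def)
      then have "pverts G - (S \<union> set xs) \<subset> pverts G - S"
        using ear(4,5) by (cases xs) auto
      then have "card (pverts G - (S \<union> set xs)) < card (pverts G - S)"
        by (intro psubset_card_mono) (simp_all add: pair_finite_verts)
      from less.hyps[OF this new] show ?thesis .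
    qed (use less in blast)
  qed
  then show ?thesis using st_coloring_edge[OF assms(2-4)] by blast
qed

section \<open>Joining descents and ascents through the edge \<open>{s, t}\<close>\<close>

lemma (in pair_graph) distance_2_proper_path_rev:
  assumes "vpath p (with_proj G)" "proper2 (map c (vpath_edges p))"
  shows "distance_2_proper_path G c p" "distance_2_proper_path G c (rev p)"
proof -
  have *: "distance_2_proper_path G c q" if "vpath q (with_proj G)" "proper2 (map c (vpath_edges q))" for q
    using that proper2_nth[OF that(2)] by (fastforce simp: distance_2_proper_path_def)
  show "distance_2_proper_path G c p" using * assms .
  show "distance_2_proper_path G c (rev p)"
    using assms vwalk_rev by (intro *) (auto simp: vpath_def vpath_edges_rev rev_map[symmetric] proper2_rev)
qed

lemma (in pair_graph) st_coloring_connecting: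
  assumes inv: "st_coloring G s t (pverts G) r c" and st: "(s, t) \<in> parcs G"
  shows "distance_2_proper_connecting G c"
proof -
  have S: "s \<in> pverts G" "t \<in> pverts G" "inj_on r (pverts G)" "r s = 0"
    "\<And>v. v \<in> pverts G \<Longrightarrow> r v \<le> r t"
    and c: "c {s, t} = 0"
    and down: "\<And>v. v \<in> pverts G \<Longrightarrow> v \<noteq> t \<Longrightarrow> \<exists>P. rooted_path G c s [0] v P \<and>
        set P \<subseteq> {w. r w \<le> r v} \<and> (v \<noteq> s \<longrightarrow> last (map c (vpath_edges P)) = 1)"
    and up: "\<And>v. v \<in> pverts G \<Longrightarrow> v \<noteq> s \<Longrightarrow> \<exists>Q. rooted_path G c t [0, 1] v Q \<and>
        set Q \<subseteq> {w. r v \<le> r w}"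
    using inv unfolding st_coloring_def by blast+
  have main: "\<exists>p. vpath p (with_proj G) \<and> hd p = u \<and> last p = v \<and> proper2 (map c (vpath_edges p))"
    if uv: "u \<in> pverts G" "v \<in> pverts G" "r u < r v" for u v
  proof -
    have "u \<noteq> t" "v \<noteq> s" using S(4) S(5)[OF uv(2)] uv(3) by auto
    then obtain P Q where P: "rooted_path G c s [0] u P" "set P \<subseteq> {w. r w \<le> r u}"
        "u \<noteq> s \<Longrightarrow> last (map c (vpath_edges P)) = 1"
      and Q: "rooted_path G c t [0, 1] v Q" "set Q \<subseteq> {w. r v \<le> r w}"
      using down up uv by metis
    obtain P' where P': "P = P' @ [s]"
      using P(1) by (cases P rule: rev_cases) (auto simp: rooted_path_def vpath_def)
    obtain Q' where Q': "Q = Q' @ [t]"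
      using Q(1) by (cases Q rule: rev_cases) (auto simp: rooted_path_def vpath_def)
    let ?p = "P @ rev Q"
    let ?\<gamma> = "map c (vpath_edges P)" and ?\<delta> = "map c (vpath_edges Q)"
    have edges: "vpath_edges ?p = vpath_edges P @ {s, t} # rev (vpath_edges Q)"
      using vpath_edges_append[of P' s "t # rev Q'"] P' Q' vpath_edges_rev[of Q] by simp
    have "vwalk (s # rev Q) (with_proj G)"
      using vwalk_rev[of Q] Q(1) S(1) st Q' by (auto simp: rooted_path_def vpath_def intro!: vwalk_consI)
    then have "vwalk ?p (with_proj G)"
      using vwalk_append[of P' s "with_proj G" "rev Q"] P(1) P' by (simp add: rooted_path_def vpath_def)
    \<comment> \<open>Numbers on \<open>P\<close> are at most \<open>r u\<close> and those on
      \<open>Q\<close> at least \<open>r v\<close>, so \<open>r u < r v\<close> keeps the two paths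
      disjoint.\<close>
    moreover have "distinct ?p"
      using P Q uv(3) by (fastforce simp: rooted_path_def vpath_def)
    moreover have "hd ?p = u" "last ?p = v"
      using P(1) Q(1) P' Q' by (auto simp: rooted_path_def hd_append last_rev)
    moreover have "proper2 (map c (vpath_edges ?p))"
    proof -
      \<comment> \<open>Reversing the ascent turns its suffix \<open>[0, 1]\<close> into a prefix
        \<open>1, 0\<close>: the color with which a nontrivial descent enters \<open>s\<close>, then
        the color of \<open>{s, t}\<close>.\<close>
      have "proper2 (rev (?\<delta> @ [0, 1]))"
        using Q(1) unfolding proper2_rev by (simp add: rooted_path_def)
      then have \<delta>: "proper2 (1 # 0 # rev ?\<delta>)" by simp
      \<comment> \<open>A trivial descent only drops the leading 1. Otherwise descent and reversed
        ascent overlap in the two entries \<open>1, 0\<close>, which is enough to glue them.\<close>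
      have "proper2 (?\<gamma> @ 0 # rev ?\<delta>)"
      proof (cases "vpath_edges P = []")
        case True
        then show ?thesis using \<delta> by simp
      next
        case False
        then have "u \<noteq> s" using P(1) vpath_hd_eq_last[of P]
          by (metis rooted_path_def vpath_edges_simps(2))
        then obtain \<gamma>' where \<gamma>': "?\<gamma> = \<gamma>' @ [1]"
          using P(3) False by (metis append_butlast_last_id map_is_Nil_conv)
        then have "proper2 (\<gamma>' @ [1, 0])" using P(1) by (simp add: rooted_path_def)
        from proper2_overlap[OF this \<delta>] show ?thesis using \<gamma>' by simp
      qed
      then show ?thesis unfolding edges using c by (simp add: rev_map)
    qed
    ultimately show ?thesis by (auto simp: vpath_def)
  qed
  show ?thesis unfolding distance_2_proper_connecting_def
  proof (intro ballI impI)
    fix u v assume uv: "u \<in> pverts G" "v \<in> pverts G" "u \<noteq> v"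
    then consider "r u < r v" | "r v < r u" using S(3) by (meson inj_onD linorder_neqE_nat)
    then show "\<exists>p. hd p = u \<and> last p = v \<and> distance_2_proper_path G c p"
    proof cases
      case 1
      then show ?thesis using main[of u v] uv distance_2_proper_path_rev(1) by blast
    next
      case 2
      then obtain p where p: "vpath p (with_proj G)" "hd p = v" "last p = u"
        "proper2 (map c (vpath_edges p))" using main[of v u] uv by blast
      then have "hd (rev p) = u" "last (rev p) = v" by (simp_all add: hd_rev last_rev)
      then show ?thesis using distance_2_proper_path_rev(2)[OF p(1,4)] by blast
    qed
  qed
qed

lemma (in pair_graph) k_connected_2_ex_arc:
  assumes "k_connected 2 G"
  shows "\<exists>s t. (s, t) \<in> parcs G"
proof -
  have "card (pverts G) > 2" using assms by (simp add: k_connected_def)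
  then obtain u v where uv: "u \<in> pverts G" "v \<in> pverts G" "u \<noteq> v"
    using card_le_Suc0_iff_eq[OF pair_finite_verts] by fastforce
  obtain w where w: "vpath w (with_proj G)" "hd w = u" "last w = v"
    using ex_vpath_avoiding[OF assms, of "{}" u v] uv by auto
  then show ?thesis using uv(3)
    by (cases w rule: vwalk_arcs.cases) (auto simp: vpath_def vwalk_def)
qed

theorem theorem3p1:
  fixes G :: "'a pair_pre_digraph"
  assumes "pair_graph G"
    and "k_connected 2 G"
  shows "pc_1_2 G \<le> 5"
proof -
  interpret pair_graph G by fact
  obtain s t where st: "(s, t) \<in> parcs G" using k_connected_2_ex_arc assms(2) by blast
  then have "s \<in> pverts G" "t \<in> pverts G" "s \<noteq> t"
    using in_arcsD1 in_arcsD2 no_loops' by auto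
  then obtain r c where rc: "st_coloring G s t (pverts G) r c"
    using st_coloring_exists[OF assms(2)] by blast
  then have "c ` edges G \<subseteq> {..<5}" by (auto simp: st_coloring_def)
  then have "card (c ` edges G) \<le> 5" using card_mono[of "{..<5}"] by fastforce
  then have "enat (card (c ` edges G)) \<le> 5" by (simp add: numeral_eq_enat)
  then show ?thesis
    unfolding pc_1_2_def using st_coloring_connecting[OF rc st] by (intro INF_lower2[of c]) auto
qed

end
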